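(* Let $\mathcal{M}=\{f(\cdot;\theta):\theta\in\Theta\}$ be a Gaussian mixture model with $K$ components and compact parameter space $\Theta\subset\mathbb{R}^D$. Let $\Theta^0=\operatorname{argmin}_{\theta\in\Theta}\mathbb{E}_{f^{\wp}}\left[-\log \mathrm{L}_{\mathrm{cc}}(\theta;X)\right]$. Let $\Theta^{\mathcal{O}}\subset\mathbb{R}^D$ be an open set over which $\log \mathrm{L}_{\mathrm{cc}}$ is defined, such that $\Theta\subset\Theta^{\mathcal{O}}$, and assume that $$M'(x)=\sup_{\theta\in\Theta^{\mathcal{O}}}\left\|\left(\frac{\partial \log \mathrm{L}_{\mathrm{cc}}}{\partial\theta}\right)_{(\theta;x)}\right\|_\infty<\infty\quad f^{\wp}d\lambda\text{-a.e.},\qquad \|M'\|_1=\mathbb{E}_{f^{\wp}}\left[|M'(X)|\right]<\infty .$$ For every $n\in\mathbb{N}^*$ let $\hat\theta=\hat\theta(X_1,\dots,X_n)\in\Theta$ be an estimator (almost) maximizing $\log \mathrm{L}_{\mathrm{cc}}$, i.e. such that $$\forall\theta^0\in\Theta^0,\ \forall n\in\mathbb{N}^*,\quad -\log \mathrm{L}_{\mathrm{cc}}(\hat\theta)\le -\log \mathrm{L}_{\mathrm{cc}}(\theta^0)+o_{\mathbb{P}}(n).$$ Then $d(\hat\theta,\Theta^0)\to 0$ in probability as $n\to\infty$.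
   Context: $X$ is a random variable in $\mathbb{R}^d$ with density $f^{\wp}$ with respect to Lebesgue measure $\lambda$, and $X_1,\dots,X_n$ is an i.i.d. sample with the same distribution; all expectations and probabilities are taken with respect to $f^{\wp}\cdot\lambda$ ($f^{\wp}$ need not belong to the model). $\mathbb{R}^D$ is equipped with $\|\theta\|_\infty=\max_i|\theta_i|$; for a linear form $l$ on $\mathbb{R}^D$, $\|l\|_\infty=\max_{\|\theta\|_\infty=1}l(\theta)$; $d(\theta,\tilde\Theta)=\inf_{\tilde\theta\in\tilde\Theta}\|\theta-\tilde\theta\|_\infty$. Gaussian mixture model: $K\ge 1$ is fixed; $f(x;\theta)=\sum_{k=1}^K\pi_k\phi(x;\omega_k)$, where $\phi(\cdot;\omega)$ is the Gaussian density on $\mathbb{R}^d$ with parameter $\omega$ = (mean in $\mathbb{R}^d$, positive definite $d\times d$ covariance matrix), $\pi_k\in[0,1]$, $\sum_k\pi_k=1$. The tuple $(\pi_1,\dots,\pi_K,\omega_1,\dots,\omega_K)$, possibly subject to constraints, is parametrized by $\theta\in\Theta\subset\mathbb{R}^D$, where $D$ (the dimension of the model) is the minimal number of free parameters. The parametrization is not assumed to be identifiable. Conditional classification log likelihood: with $\tau_k(x;\theta)=\pi_k\phi(x;\omega_k)/\sum_{k'=1}^K\pi_{k'}\phi(x;\omega_{k'})$ and the convention $0\log 0=0$, for a single observation $$\log \mathrm{L}_{\mathrm{cc}}(\theta;x)=\log\Big(\sum_{k=1}^K\pi_k\phi(x;\omega_k)\Big)+\sum_{k=1}^K\tau_k(x;\theta)\log\tau_k(x;\theta),$$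 and for the sample $\log \mathrm{L}_{\mathrm{cc}}(\theta)=\sum_{i=1}^n\log \mathrm{L}_{\mathrm{cc}}(\theta;X_i)$. Standing assumptions: $\mathbb{E}_{f^{\wp}}[\log \mathrm{L}_{\mathrm{cc}}(\theta;X)]$ exists (is finite) for the parameters considered, and $\theta\mapsto\log \mathrm{L}_{\mathrm{cc}}(\theta;x)$ is defined and $C^1$ on $\Theta^{\mathcal{O}}$ for $f^{\wp}d\lambda$-almost all $x$. *)

theory Defs
  imports "HOL-Probability.Probability"
begin

definition pos_def_matrix :: "real^'d^'d \<Rightarrow> bool" where
  "pos_def_matrix S \<longleftrightarrow> transpose S = S \<and> (\<forall>v. v \<noteq> 0 \<longrightarrow> 0 < v \<bullet> (S *v v))"

definition gauss_density :: "(real^'d) \<times> (real^'d^'d) \<Rightarrow> real^'d \<Rightarrow> real" where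
  "gauss_density w x = (case w of (m, S) \<Rightarrow>
     exp (- ((x - m) \<bullet> (matrix_inv S *v (x - m))) / 2) / sqrt ((2 * pi) ^ CARD('d) * det S))"

text \<open>Mixing proportions and component parameters (mean, covariance).  The components of a
  \<open>K\<close>-component mixture are those with index in \<open>{1..K}\<close>; values at other indices are
  irrelevant.\<close>

type_synonym 'd mixture = "(nat \<Rightarrow> real) \<times> (nat \<Rightarrow> (real^'d) \<times> (real^'d^'d))"

definition is_gaussian_mixture :: "nat \<Rightarrow> 'd::finite mixture \<Rightarrow> bool" where
  "is_gaussian_mixture K p \<longleftrightarrow>
     (\<forall>k\<in>{1..K}. 0 \<le> fst p k \<and> fst p k \<le> 1 \<and> pos_def_matrix (snd (snd p k))) \<and>
     (\<Sum>k=1..K. fst p k) = 1"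

definition mixture_density :: "nat \<Rightarrow> 'd::finite mixture \<Rightarrow> real^'d \<Rightarrow> real" where
  "mixture_density K p x = (\<Sum>k=1..K. fst p k * gauss_density (snd p k) x)"

definition tau :: "nat \<Rightarrow> 'd::finite mixture \<Rightarrow> nat \<Rightarrow> real^'d \<Rightarrow> real" where
  "tau K p k x = fst p k * gauss_density (snd p k) x / mixture_density K p x"

text \<open>The convention \<open>0 log 0 = 0\<close> holds automatically.\<close>

definition log_Lcc :: "nat \<Rightarrow> 'd::finite mixture \<Rightarrow> real^'d \<Rightarrow> real" where
  "log_Lcc K p x = ln (mixture_density K p x) + (\<Sum>k=1..K. tau K p k x * ln (tau K p k x))"

text \<open>Since \<open>ln\<close> is total in HOL, well-definedness of \<open>log_Lcc\<close> has to be stated separately.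
  The proportions need not sum to \<open>1\<close> here: this predicate is meant for an open
  neighbourhood of the parameter space, over which only the criterion has to make sense.\<close>

definition log_Lcc_defined :: "nat \<Rightarrow> 'd::finite mixture \<Rightarrow> real^'d \<Rightarrow> bool" where
  "log_Lcc_defined K p x \<longleftrightarrow>
     (\<forall>k\<in>{1..K}. pos_def_matrix (snd (snd p k))) \<and>
     0 < mixture_density K p x \<and> (\<forall>k\<in>{1..K}. 0 \<le> tau K p k x)"

definition sample_log_Lcc :: "nat \<Rightarrow> 'd::finite mixture \<Rightarrow> nat \<Rightarrow> (nat \<Rightarrow> real^'d) \<Rightarrow> real" where
  "sample_log_Lcc K p n xs = (\<Sum>i=1..n. log_Lcc K p (xs i))"

definition C1_on ::
  "('a::real_normed_vector \<Rightarrow> 'b::real_normed_vector) \<Rightarrow> 'a set \<Rightarrow> bool" where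
  "C1_on g S \<longleftrightarrow> (\<exists>g' :: 'a \<Rightarrow> 'a \<Rightarrow>\<^sub>L 'b.
     (\<forall>t\<in>S. (g has_derivative blinfun_apply (g' t)) (at t)) \<and> continuous_on S g')"

text \<open>These are the real \<open>Sup\<close>/\<open>Inf\<close>; the distance is only meaningful for nonempty \<open>S\<close>.\<close>

definition infnorm_form :: "('a::euclidean_space \<Rightarrow> real) \<Rightarrow> real" where
  "infnorm_form l = (SUP t\<in>{t. infnorm t = 1}. l t)"

definition infnorm_dist :: "'a::euclidean_space \<Rightarrow> 'a set \<Rightarrow> real" where
  "infnorm_dist t S = (INF s\<in>S. infnorm (t - s))"

text \<open>The supremum is taken in \<open>ennreal\<close>, so that its finiteness is a genuine condition.\<close>

definition sup_deriv_norm ::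
  "('t::euclidean_space \<Rightarrow> 'x \<Rightarrow> real) \<Rightarrow> 't set \<Rightarrow> 'x \<Rightarrow> ennreal" where
  "sup_deriv_norm L S x =
     (SUP t\<in>S. ennreal (infnorm_form (frechet_derivative (\<lambda>u. L u x) (at t))))"

definition tends_to_0_in_prob :: "'w measure \<Rightarrow> (nat \<Rightarrow> 'w \<Rightarrow> real) \<Rightarrow> bool" where
  "tends_to_0_in_prob M Z \<longleftrightarrow>
     (\<forall>e>0. (\<lambda>n. measure M {w \<in> space M. e < \<bar>Z n w\<bar>}) \<longlonglongrightarrow> 0)"

definition little_o_prob :: "'w measure \<Rightarrow> (nat \<Rightarrow> 'w \<Rightarrow> real) \<Rightarrow> (nat \<Rightarrow> real) \<Rightarrow> bool" where
  "little_o_prob M R a \<longleftrightarrow>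
     (\<forall>n\<ge>1. R n \<in> borel_measurable M) \<and> tends_to_0_in_prob M (\<lambda>n w. R n w / a n)"

end

theory Submission
  imports Defs "HOL-Real_Asymp.Real_Asymp"
begin

text \<open>The assertion is a consistency theorem for an almost-minimizer of an empirical risk, and the
  only role of the Gaussian mixture is to provide a loss \<open>g \<theta> x = - log_Lcc K (par \<theta>) x\<close> with an
  integrable Lipschitz bound.  The argument is Wald's.

  The bound on the derivative makes the loss locally equicontinuous in \<open>L\<^sup>1\<close>: around each \<open>\<theta> \<in> \<Theta>\<close>
  there is a ball on which \<open>\<bar>g \<theta>' x - g \<theta> x\<bar> \<le> B x\<close> for almost all \<open>x\<close>, where \<open>B\<close> is integrable with
  arbitrarily small integral (\<open>L1_continuous_at_of_deriv_bound\<close>).  Hence the risk \<open>\<theta> \<mapsto> \<integral>g \<theta>\<close> is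
  continuous on the compact set \<open>\<Theta>\<close> and attains its minimum, say at \<open>\<theta>0\<close>.

  If \<open>\<theta>\<close> is not a minimizer, choose the ball so small that \<open>W = g \<theta> - B - g \<theta>0\<close> has positive mean.
  Whenever the estimator lies in this ball, the empirical mean of \<open>W\<close> is at most the excess empirical
  risk of the estimator over \<open>\<theta>0\<close>, which is bounded above by a term tending to \<open>0\<close> in probability;
  by the weak law of large numbers this has vanishing probability (\<open>local_exclusion\<close>).  The parameters at distance at least \<open>e\<close> from the set of
  minimizers form a compact set, so finitely many such balls cover it, and the probabilities add up
  (\<open>argmin_estimator_consistent\<close>).

  The weak law is proved for integrable variables by truncation, the bounded part being controlled by
  Hoeffding's inequality.\<close>

section \<open>The weak law of large numbers\<close>

lemma integrable_tail_small:
  fixes h :: "'a \<Rightarrow> real"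
  assumes "integrable P h" and "0 < d"
  shows "\<exists>c>0. (\<integral>x. \<bar>h x\<bar> * indicator {x. c < \<bar>h x\<bar>} x \<partial>P) < d"
proof -
  have [measurable]: "h \<in> borel_measurable P" using assms by simp
  have "(\<lambda>n. \<integral>x. \<bar>h x\<bar> * indicator {x. real n < \<bar>h x\<bar>} x \<partial>P) \<longlonglongrightarrow> (\<integral>x. 0 \<partial>P)"
  proof (rule integral_dominated_convergence[where w = "\<lambda>x. \<bar>h x\<bar>"])
    show "AE x in P. (\<lambda>n. \<bar>h x\<bar> * indicator {x. real n < \<bar>h x\<bar>} x) \<longlonglongrightarrow> 0"
    proof (rule AE_I2)
      fix x
      have "eventually (\<lambda>n. \<bar>h x\<bar> * indicator {x. real n < \<bar>h x\<bar>} x = 0) sequentially"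
        using eventually_ge_at_top[of "nat \<lceil>\<bar>h x\<bar>\<rceil>"] by eventually_elim (auto simp: indicator_def)
      then show "(\<lambda>n. \<bar>h x\<bar> * indicator {x. real n < \<bar>h x\<bar>} x) \<longlonglongrightarrow> 0"
        by (rule tendsto_eventually)
    qed
  qed (use assms in \<open>auto simp: indicator_def\<close>)
  then have "eventually (\<lambda>n. (\<integral>x. \<bar>h x\<bar> * indicator {x. real n < \<bar>h x\<bar>} x \<partial>P) < d) sequentially"
    using assms(2) by (simp add: order_tendstoD(2))
  then have "eventually (\<lambda>n. 0 < n \<and> (\<integral>x. \<bar>h x\<bar> * indicator {x. real n < \<bar>h x\<bar>} x \<partial>P) < d) sequentially"
    by (rule eventually_conj[OF eventually_gt_at_top])
  then obtain n where "0 < n" "(\<integral>x. \<bar>h x\<bar> * indicator {x. real n < \<bar>h x\<bar>} x \<partial>P) < d"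
    using eventually_happens'[OF sequentially_bot] by blast
  then show ?thesis by (intro exI[of _ "real n"]) auto
qed

text \<open>An i.i.d. sequence \<open>X 1, X 2, \<dots>\<close> in the measurable space \<open>N\<close> with common distribution \<open>P\<close>; the
  variable \<open>X 0\<close> is unconstrained.\<close>

locale iid_sample = prob_space M
  for M :: "'w measure" +
  fixes N P :: "'x measure" and X :: "nat \<Rightarrow> 'w \<Rightarrow> 'x"
  assumes indep: "indep_vars (\<lambda>_. N) X {1..}"
    and distr_X: "1 \<le> i \<Longrightarrow> distr M N (X i) = P"
begin

lemma measurable_X: "1 \<le> i \<Longrightarrow> X i \<in> measurable M N"
  using indep by (auto simp: indep_vars_def)

lemma measurable_P: "h \<in> measurable P L \<longleftrightarrow> h \<in> measurable N L"
  using distr_X[of 1] by (auto simp: measurable_distr_eq1)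

lemma measurable_comp_X:
  "h \<in> measurable P L \<Longrightarrow> 1 \<le> i \<Longrightarrow> (\<lambda>w. h (X i w)) \<in> measurable M L"
  using measurable_compose[OF measurable_X] by (simp add: measurable_P)

lemma
  fixes h :: "'x \<Rightarrow> real"
  assumes "1 \<le> i" "h \<in> borel_measurable P"
  shows integrable_comp_X: "integrable M (\<lambda>w. h (X i w)) \<longleftrightarrow> integrable P h"
    and integral_comp_X: "(\<integral>w. h (X i w) \<partial>M) = (\<integral>x. h x \<partial>P)"
  using assms distr_X[OF assms(1)] measurable_X[OF assms(1)]
  by (auto simp: measurable_P integrable_distr_eq[symmetric] integral_distr[symmetric])

lemma AE_comp_X: "AE x in P. Q x \<Longrightarrow> 1 \<le> i \<Longrightarrow> AE w in M. Q (X i w)"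
  using AE_distrD[OF measurable_X] distr_X by metis

lemma weak_law_bounded:
  fixes h :: "'x \<Rightarrow> real"
  assumes h [measurable]: "h \<in> borel_measurable P" and c: "0 < c" "\<And>x. \<bar>h x\<bar> \<le> c"
  shows "tends_to_0_in_prob M (\<lambda>n w. (\<Sum>i=1..n. h (X i w)) / real n - (\<integral>x. h x \<partial>P))"
  unfolding tends_to_0_in_prob_def
proof (intro allI impI)
  fix e :: real assume e: "0 < e"
  let ?Z = "\<lambda>n w. (\<Sum>i=1..n. h (X i w)) / real n - (\<integral>x. h x \<partial>P)"
  have bound: "prob {w \<in> space M. e < \<bar>?Z n w\<bar>} \<le> 2 * exp (- 2 * real n * e\<^sup>2 / (2 * c)\<^sup>2)"
    if n: "1 \<le> n" for n
  proof -
    have m [measurable]: "(\<lambda>w. h (X i w)) \<in> borel_measurable M" if "1 \<le> i" for i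
      using measurable_comp_X[OF h that] .
    interpret Hoeffding_ineq_iid M "{1..n}" "\<lambda>i w. h (X i w)" "\<lambda>w. h (X 1 w)" "- c" c "\<integral>x. h x \<partial>P"
    proof unfold_locales
      show "indep_vars (\<lambda>_. borel) (\<lambda>i w. h (X i w)) {1..n}"
        by (rule indep_vars_compose2[where M' = "\<lambda>_. N"])
           (use indep h in \<open>auto intro: indep_vars_subset simp: measurable_P\<close>)
      show "distr M borel (\<lambda>w. h (X i w)) = distr M borel (\<lambda>w. h (X 1 w))" if "i \<in> {1..n}" for i
      proof -
        have eq: "distr M borel (\<lambda>w. h (X j w)) = distr P borel h" if "1 \<le> j" for j
          using distr_distr[of h N borel "X j" M] h measurable_X[OF that] distr_X[OF that]
          by (simp add: measurable_P comp_def)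
        show ?thesis using that by (simp add: eq)
      qed
      show "AE w in M. h (X 1 w) \<in> {- c..c}"
        using c(2) by (auto simp: abs_le_iff minus_le_iff)
      show "(\<integral>x. h x \<partial>P) \<equiv> expectation (\<lambda>w. h (X 1 w))"
        using integral_comp_X[of 1 h] by simp
    qed auto
    have "prob {w \<in> space M. e < \<bar>?Z n w\<bar>} \<le> prob {w \<in> space M. \<bar>(\<Sum>i=1..n. h (X i w)) / real n - (\<integral>x. h x \<partial>P)\<bar> \<ge> e}"
      by (intro finite_measure_mono) auto
    also have "\<dots> \<le> 2 * exp (- 2 * real n * e\<^sup>2 / (c - - c)\<^sup>2)"
      using Hoeffding_ineq_abs_ge'[of e] e c n by simp
    finally show ?thesis by simp
  qed
  have "(\<lambda>n. 2 * exp (- 2 * real n * e\<^sup>2 / (2 * c)\<^sup>2)) \<longlonglongrightarrow> 0"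
    using e c by real_asymp
  then show "(\<lambda>n. prob {w \<in> space M. e < \<bar>?Z n w\<bar>}) \<longlonglongrightarrow> 0"
    by (rule Lim_null_comparison[rotated]) (use bound in \<open>auto intro!: eventually_sequentiallyI[of 1]\<close>)
qed

text \<open>The integrand is cut at a level \<open>c\<close>: the bounded part \<open>h1\<close> obeys \<open>weak_law_bounded\<close>, and the
  remainder \<open>h2\<close>, of small \<open>L\<^sup>1\<close> norm, is handled by Markov's inequality.\<close>

theorem weak_law_of_large_numbers:
  fixes h :: "'x \<Rightarrow> real"
  assumes h: "integrable P h"
  shows "tends_to_0_in_prob M (\<lambda>n w. (\<Sum>i=1..n. h (X i w)) / real n - (\<integral>x. h x \<partial>P))"
  unfolding tends_to_0_in_prob_def
proof (intro allI impI)
  fix e :: real assume e: "0 < e"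
  let ?Z = "\<lambda>n w. (\<Sum>i=1..n. h (X i w)) / real n - (\<integral>x. h x \<partial>P)"
  have hm [measurable]: "h \<in> borel_measurable P" using h by simp
  show "(\<lambda>n. prob {w \<in> space M. e < \<bar>?Z n w\<bar>}) \<longlonglongrightarrow> 0"
    unfolding tendsto_iff dist_real_def
  proof (intro allI impI)
    fix d :: real assume d: "0 < d"
    obtain c where c: "0 < c"
      and tail: "(\<integral>x. \<bar>h x\<bar> * indicator {x. c < \<bar>h x\<bar>} x \<partial>P) < min (e / 3) (d * e / 6)"
      using integrable_tail_small[OF h, of "min (e / 3) (d * e / 6)"] e d by auto
    define h1 where "h1 = (\<lambda>x. h x * indicator {x. \<bar>h x\<bar> \<le> c} x)"
    define h2 where "h2 = (\<lambda>x. h x * indicator {x. c < \<bar>h x\<bar>} x)"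
    have split: "h x = h1 x + h2 x" for x by (auto simp: h1_def h2_def indicator_def)
    have [measurable]: "h1 \<in> borel_measurable P" "h2 \<in> borel_measurable P"
      unfolding h1_def h2_def by measurable
    have ih: "integrable P h1" "integrable P h2"
      by (auto intro!: Bochner_Integration.integrable_bound[OF h] simp: h1_def h2_def indicator_def)
    have abs2: "\<bar>h2 x\<bar> = \<bar>h x\<bar> * indicator {x. c < \<bar>h x\<bar>} x" for x
      by (auto simp: h2_def indicator_def)
    have E2: "(\<integral>x. \<bar>h2 x\<bar> \<partial>P) < e / 3" "(\<integral>x. \<bar>h2 x\<bar> \<partial>P) < d * e / 6"
      using tail by (auto simp: abs2)
    have mu2: "\<bar>\<integral>x. h2 x \<partial>P\<bar> < e / 3"
      using integral_abs_bound[of P h2] E2 by linarith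
    let ?Z1 = "\<lambda>n w. (\<Sum>i=1..n. h1 (X i w)) / real n - (\<integral>x. h1 x \<partial>P)"
    let ?Z2 = "\<lambda>n w. (\<Sum>i=1..n. \<bar>h2 (X i w)\<bar>) / real n"
    have "tends_to_0_in_prob M ?Z1"
      by (rule weak_law_bounded[of h1 c]) (use c in \<open>auto simp: h1_def indicator_def\<close>)
    then have "(\<lambda>n. prob {w \<in> space M. e / 3 < \<bar>?Z1 n w\<bar>}) \<longlonglongrightarrow> 0"
      using e unfolding tends_to_0_in_prob_def by (meson divide_pos_pos zero_less_numeral)
    then have "eventually (\<lambda>n. prob {w \<in> space M. e / 3 < \<bar>?Z1 n w\<bar>} < d / 2) sequentially"
      by (rule order_tendstoD(2)) (use d in simp)
    then show "eventually (\<lambda>n. \<bar>prob {w \<in> space M. e < \<bar>?Z n w\<bar>} - 0\<bar> < d) sequentially"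
      using eventually_ge_at_top[of 1]
    proof eventually_elim
      case (elim n)
      have m [measurable]: "(\<lambda>w. h (X i w)) \<in> borel_measurable M" "(\<lambda>w. h1 (X i w)) \<in> borel_measurable M"
        "(\<lambda>w. h2 (X i w)) \<in> borel_measurable M" if "1 \<le> i" for i
        using that by (simp_all add: measurable_comp_X[of h] measurable_comp_X[of h1] measurable_comp_X[of h2])
      have i2: "integrable M (\<lambda>w. \<bar>h2 (X i w)\<bar>)" if "1 \<le> i" for i
        using integrable_comp_X[OF that, of "\<lambda>x. \<bar>h2 x\<bar>"] ih by simp
      have iZ: "integrable M (?Z2 n)"
        by (intro integrable_divide Bochner_Integration.integrable_sum i2) simp
      have "prob {w \<in> space M. e / 3 \<le> ?Z2 n w} \<le> (\<integral>w. ?Z2 n w \<partial>M) / (e / 3)"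
        by (rule integral_Markov_inequality_measure[OF iZ, where A = "{}"])
           (use e in \<open>simp_all add: sum_nonneg\<close>)
      also have "(\<integral>w. ?Z2 n w \<partial>M) = (\<integral>x. \<bar>h2 x\<bar> \<partial>P)"
      proof -
        have "(\<integral>w. ?Z2 n w \<partial>M) = (\<Sum>i=1..n. \<integral>w. \<bar>h2 (X i w)\<bar> \<partial>M) / real n"
          by (subst Bochner_Integration.integral_sum[symmetric]) (simp_all add: i2)
        also have "(\<Sum>i=1..n. \<integral>w. \<bar>h2 (X i w)\<bar> \<partial>M) = (\<Sum>i=1..n. \<integral>x. \<bar>h2 x\<bar> \<partial>P)"
          by (intro sum.cong refl integral_comp_X) simp_all
        finally show ?thesis using elim(2) by simp
      qed
      also have "\<dots> / (e / 3) < d / 2"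
        using E2 e by (simp add: field_simps)
      finally have P2: "prob {w \<in> space M. e / 3 \<le> ?Z2 n w} < d / 2" .
      have "\<bar>?Z n w\<bar> \<le> e" if "\<bar>?Z1 n w\<bar> \<le> e / 3" "?Z2 n w < e / 3" for w
      proof -
        have "(\<Sum>i=1..n. h (X i w)) = (\<Sum>i=1..n. h1 (X i w)) + (\<Sum>i=1..n. h2 (X i w))"
          by (simp only: split sum.distrib)
        moreover have "(\<integral>x. h x \<partial>P) = (\<integral>x. h1 x \<partial>P) + (\<integral>x. h2 x \<partial>P)"
          by (simp only: split Bochner_Integration.integral_add[OF ih])
        ultimately have "?Z n w = ?Z1 n w + (\<Sum>i=1..n. h2 (X i w)) / real n - (\<integral>x. h2 x \<partial>P)"
          by (simp only: add_divide_distrib)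
        moreover have "\<bar>(\<Sum>i=1..n. h2 (X i w)) / real n\<bar> \<le> ?Z2 n w"
          by (simp add: abs_divide divide_right_mono sum_abs)
        ultimately show ?thesis using that mu2 by linarith
      qed
      then have "{w \<in> space M. e < \<bar>?Z n w\<bar>}
          \<subseteq> {w \<in> space M. e / 3 < \<bar>?Z1 n w\<bar>} \<union> {w \<in> space M. e / 3 \<le> ?Z2 n w}"
        by (smt (verit) Un_iff mem_Collect_eq subsetI)
      then have "prob {w \<in> space M. e < \<bar>?Z n w\<bar>}
          \<le> prob ({w \<in> space M. e / 3 < \<bar>?Z1 n w\<bar>} \<union> {w \<in> space M. e / 3 \<le> ?Z2 n w})"
        by (intro finite_measure_mono) auto
      also have "\<dots> \<le> prob {w \<in> space M. e / 3 < \<bar>?Z1 n w\<bar>} + prob {w \<in> space M. e / 3 \<le> ?Z2 n w}"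
        by (intro measure_Un_le) auto
      finally show ?case using P2 elim by simp
    qed
  qed
qed

end

section \<open>Losses that are locally equicontinuous in the mean\<close>

text \<open>The loss \<open>g\<close> is controlled near \<open>t\<close>, simultaneously for all parameters of \<open>T\<close> in a small ball,
  by a function of small integral.  The exceptional null set is common to all these parameters.
  Using a bound \<open>B\<close> avoids any measurability question about the supremum over the ball.\<close>

definition L1_continuous_at ::
  "'x measure \<Rightarrow> ('t::metric_space \<Rightarrow> 'x \<Rightarrow> real) \<Rightarrow> 't set \<Rightarrow> 't \<Rightarrow> bool" where
  "L1_continuous_at P g T t \<longleftrightarrow>
     (\<forall>e>0. \<exists>r>0. \<exists>B. integrable P B \<and> (\<integral>x. B x \<partial>P) \<le> e \<and>
        (AE x in P. \<forall>s\<in>T \<inter> ball t r. \<bar>g s x - g t x\<bar> \<le> B x))"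

lemma L1_continuous_atE:
  assumes "L1_continuous_at P g T t" "0 < e"
  obtains r B where "0 < r" "integrable P B" "(\<integral>x. B x \<partial>P) \<le> e"
    "AE x in P. \<forall>s\<in>T \<inter> ball t r. \<bar>g s x - g t x\<bar> \<le> B x"
  using assms unfolding L1_continuous_at_def by blast

lemma L1_continuous_at_uminus:
  assumes "L1_continuous_at P g T t"
  shows "L1_continuous_at P (\<lambda>t x. - g t x) T t"
proof -
  have "\<bar>- a - - b\<bar> = \<bar>a - b\<bar>" for a b :: real by linarith
  with assms show ?thesis unfolding L1_continuous_at_def by simp
qed

lemma continuous_on_integral_L1:
  assumes int: "\<And>t. t \<in> T \<Longrightarrow> integrable P (g t)"
    and cont: "\<And>t. t \<in> T \<Longrightarrow> L1_continuous_at P g T t"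
  shows "continuous_on T (\<lambda>t. \<integral>x. g t x \<partial>P)"
  unfolding continuous_on_iff
proof (intro ballI allI impI)
  fix t and e :: real assume t: "t \<in> T" and e: "0 < e"
  obtain r B where r: "0 < r" and B: "integrable P B" "(\<integral>x. B x \<partial>P) \<le> e / 2"
    and AE: "AE x in P. \<forall>s\<in>T \<inter> ball t r. \<bar>g s x - g t x\<bar> \<le> B x"
    using L1_continuous_atE[OF cont[OF t], of "e / 2"] e by auto
  show "\<exists>d>0. \<forall>s\<in>T. dist s t < d \<longrightarrow> dist (\<integral>x. g s x \<partial>P) (\<integral>x. g t x \<partial>P) < e"
  proof (intro exI[of _ r] conjI ballI impI r)
    fix s assume s: "s \<in> T" "dist s t < r"
    have "\<bar>\<integral>x. g s x - g t x \<partial>P\<bar> \<le> (\<integral>x. \<bar>g s x - g t x\<bar> \<partial>P)"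
      by (rule integral_abs_bound)
    also have "\<dots> \<le> (\<integral>x. B x \<partial>P)"
    proof (rule integral_mono_AE)
      show "AE x in P. \<bar>g s x - g t x\<bar> \<le> B x"
        using AE by eventually_elim (use s in \<open>auto simp: dist_commute\<close>)
    qed (use B int s t in auto)
    also have "\<dots> < e" using B e by linarith
    finally show "dist (\<integral>x. g s x \<partial>P) (\<integral>x. g t x \<partial>P) < e"
      using int s t by (simp add: dist_real_def)
  qed
qed

section \<open>Consistency of almost-minimizers of the empirical risk\<close>

context iid_sample
begin

text \<open>An almost-minimizer avoids a neighbourhood of every parameter of non-minimal risk.  The event
  that it enters that neighbourhood need not be measurable, so it is enclosed, up to a null set, in
  measurable events \<open>E n\<close>.\<close>

lemma local_exclusion:
  fixes g :: "'t::metric_space \<Rightarrow> 'x \<Rightarrow> real"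
  assumes int: "integrable P (g t)" "integrable P (g t0)"
    and gap: "(\<integral>x. g t0 x \<partial>P) < (\<integral>x. g t x \<partial>P)"
    and cont: "L1_continuous_at P g T t"
    and hat: "\<And>n w. 1 \<le> n \<Longrightarrow> w \<in> space M \<Longrightarrow> hat n w \<in> T"
    and R: "little_o_prob M R real"
    and opt: "\<And>n. 1 \<le> n \<Longrightarrow>
      AE w in M. (\<Sum>i=1..n. g (hat n w) (X i w)) \<le> (\<Sum>i=1..n. g t0 (X i w)) + R n w"
  shows "\<exists>r>0. \<exists>E. (\<forall>n\<ge>1. E n \<in> events \<and> (AE w in M. hat n w \<in> ball t r \<longrightarrow> w \<in> E n)) \<and>
    (\<lambda>n. prob (E n)) \<longlonglongrightarrow> 0"
proof -
  let ?gap = "(\<integral>x. g t x \<partial>P) - (\<integral>x. g t0 x \<partial>P)"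
  obtain r B where r: "0 < r" and B: "integrable P B" "(\<integral>x. B x \<partial>P) \<le> ?gap / 2"
    and AE: "AE x in P. \<forall>s\<in>T \<inter> ball t r. \<bar>g s x - g t x\<bar> \<le> B x"
    using L1_continuous_atE[OF cont, of "?gap / 2"] gap by auto
  \<comment> \<open>\<open>W\<close> bounds from below the excess loss over \<open>t0\<close> throughout the ball, and still has positive mean.\<close>
  define W where "W = (\<lambda>x. g t x - B x - g t0 x)"
  define \<mu> where "\<mu> = (\<integral>x. W x \<partial>P)"
  have W: "integrable P W" unfolding W_def using int B by auto
  then have Wm: "W \<in> borel_measurable P" by simp
  have "\<mu> = (\<integral>x. g t x \<partial>P) - (\<integral>x. B x \<partial>P) - (\<integral>x. g t0 x \<partial>P)"
    unfolding \<mu>_def W_def using int B by simp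
  with B gap have \<mu>: "0 < \<mu>" by simp
  define E where "E = (\<lambda>n. {w \<in> space M. \<mu> / 3 < \<bar>(\<Sum>i=1..n. W (X i w)) / real n - \<mu>\<bar>} \<union>
    {w \<in> space M. \<mu> / 3 < \<bar>R n w / real n\<bar>})"
  let ?E1 = "\<lambda>n. {w \<in> space M. \<mu> / 3 < \<bar>(\<Sum>i=1..n. W (X i w)) / real n - \<mu>\<bar>}"
  let ?E2 = "\<lambda>n. {w \<in> space M. \<mu> / 3 < \<bar>R n w / real n\<bar>}"
  have E12: "?E1 n \<in> events" "?E2 n \<in> events" if n: "1 \<le> n" for n
  proof -
    have [measurable]: "R n \<in> borel_measurable M" using R n by (auto simp: little_o_prob_def)
    have [measurable]: "(\<lambda>w. W (X i w)) \<in> borel_measurable M" if "1 \<le> i" for i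
      using measurable_comp_X[OF Wm that] .
    have [measurable]: "(\<lambda>w. \<Sum>i=1..n. W (X i w)) \<in> borel_measurable M"
      by (rule borel_measurable_sum) simp
    show "?E1 n \<in> events" "?E2 n \<in> events" by measurable
  qed
  have "AE w in M. hat n w \<in> ball t r \<longrightarrow> w \<in> E n" if n: "1 \<le> n" for n
  proof -
    have "AE w in M. \<forall>i\<in>{1..n}. \<forall>s\<in>T \<inter> ball t r. \<bar>g s (X i w) - g t (X i w)\<bar> \<le> B (X i w)"
      by (intro AE_finite_allI AE_comp_X[OF AE]) auto
    with opt[OF n] AE_space show ?thesis
    proof eventually_elim
      case (elim w)
      show ?case
      proof
        assume ball: "hat n w \<in> ball t r"
        have "(\<Sum>i=1..n. W (X i w)) \<le> (\<Sum>i=1..n. g (hat n w) (X i w) - g t0 (X i w))"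
        proof (rule sum_mono)
          fix i assume "i \<in> {1..n}"
          then have "\<bar>g (hat n w) (X i w) - g t (X i w)\<bar> \<le> B (X i w)"
            using elim hat[OF n] ball by blast
          then show "W (X i w) \<le> g (hat n w) (X i w) - g t0 (X i w)"
            unfolding W_def by linarith
        qed
        also have "\<dots> \<le> R n w" using elim by (simp add: sum_subtractf)
        finally have "(\<Sum>i=1..n. W (X i w)) / real n \<le> R n w / real n"
          by (rule divide_right_mono) simp
        moreover have "\<mu> / 3 < \<bar>a - \<mu>\<bar> \<or> \<mu> / 3 < \<bar>b\<bar>" if "a \<le> b" for a b :: real
          using that \<mu> by linarith
        ultimately show "w \<in> E n" unfolding E_def using elim(2) by blast
      qed
    qed
  qed
  moreover have "E n \<in> events" if "1 \<le> n" for n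
    unfolding E_def using E12[OF that] by auto
  moreover have "(\<lambda>n. prob (E n)) \<longlonglongrightarrow> 0"
  proof (rule Lim_null_comparison)
    have "(\<lambda>n. prob (?E1 n)) \<longlonglongrightarrow> 0"
      using weak_law_of_large_numbers[OF W, unfolded tends_to_0_in_prob_def, rule_format, of "\<mu> / 3"] \<mu>
      unfolding \<mu>_def by simp
    moreover have "(\<lambda>n. prob (?E2 n)) \<longlonglongrightarrow> 0"
      using R[unfolded little_o_prob_def tends_to_0_in_prob_def, THEN conjunct2, rule_format, of "\<mu> / 3"] \<mu>
      by simp
    ultimately show "(\<lambda>n. prob (?E1 n) + prob (?E2 n)) \<longlonglongrightarrow> 0"
      by (rule tendsto_add_zero)
    show "eventually (\<lambda>n. norm (prob (E n)) \<le> prob (?E1 n) + prob (?E2 n)) sequentially"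
      using eventually_ge_at_top[of 1]
    proof eventually_elim
      case (elim n)
      show ?case using measure_Un_le[OF E12[OF elim]] unfolding E_def by simp
    qed
  qed
  ultimately show ?thesis using r by blast
qed

theorem argmin_estimator_consistent:
  fixes g :: "'t::euclidean_space \<Rightarrow> 'x \<Rightarrow> real" and T :: "'t set"
  defines "T0 \<equiv> {t. is_arg_min (\<lambda>t. \<integral>x. g t x \<partial>P) (\<lambda>t. t \<in> T) t}"
  assumes T: "compact T" "T \<noteq> {}"
    and int: "\<And>t. t \<in> T \<Longrightarrow> integrable P (g t)"
    and cont: "\<And>t. t \<in> T \<Longrightarrow> L1_continuous_at P g T t"
    and hat: "\<And>n w. 1 \<le> n \<Longrightarrow> w \<in> space M \<Longrightarrow> hat n w \<in> T"
    and opt: "\<And>t0. t0 \<in> T0 \<Longrightarrow> \<exists>R. little_o_prob M R real \<and> (\<forall>n\<ge>1. AE w in M.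
      (\<Sum>i=1..n. g (hat n w) (X i w)) \<le> (\<Sum>i=1..n. g t0 (X i w)) + R n w)"
  shows "tends_to_0_in_prob M (\<lambda>n w. infnorm_dist (hat n w) T0)"
  unfolding tends_to_0_in_prob_def
proof (intro allI impI)
  fix e :: real assume e: "0 < e"
  obtain t0 where "t0 \<in> T" "\<And>t. t \<in> T \<Longrightarrow> (\<integral>x. g t0 x \<partial>P) \<le> (\<integral>x. g t x \<partial>P)"
    using continuous_attains_inf[OF T continuous_on_integral_L1[OF int cont]] by blast
  then have t0: "t0 \<in> T" "t0 \<in> T0"
    unfolding T0_def is_arg_min_linorder by auto
  obtain R where R: "little_o_prob M R real" and opt0: "\<And>n. 1 \<le> n \<Longrightarrow> AE w in M.
      (\<Sum>i=1..n. g (hat n w) (X i w)) \<le> (\<Sum>i=1..n. g t0 (X i w)) + R n w"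
    using opt[OF t0(2)] by blast
  have gap: "(\<integral>x. g t0 x \<partial>P) < (\<integral>x. g t x \<partial>P)" if "t \<in> T" "t \<notin> T0" for t
    using that t0(2) unfolding T0_def is_arg_min_linorder by force
  \<comment> \<open>Deleting open balls from \<open>T\<close>, rather than bounding the distance function, gives compactness at once.\<close>
  define C where "C = T - (\<Union>s\<in>T0. {t. infnorm (t - s) < e})"
  have "open {t :: 't. infnorm (t - s) < e}" for s
    by (intro open_Collect_less continuous_intros)
  then have "compact C" unfolding C_def by (intro compact_diff T open_UN) auto
  have C_T0: "t \<notin> T0" if "t \<in> C" for t
    using that e unfolding C_def by (auto simp: infnorm_0)
  \<comment> \<open>The conclusion of \<open>local_exclusion\<close>, packaged so that radii and events can be chosen for all \<open>t\<close>.\<close>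
  define excl where "excl = (\<lambda>t r E. 0 < r \<and>
    (\<forall>n\<ge>1. E n \<in> events \<and> (AE w in M. hat n w \<in> ball t r \<longrightarrow> w \<in> E n)) \<and>
    (\<lambda>n. prob (E n)) \<longlonglongrightarrow> 0)"
  have "\<exists>r E. excl t r E" if "t \<in> C" for t
  proof -
    have "t \<in> T" "t \<notin> T0" using that C_T0[OF that] unfolding C_def by blast+
    then have "\<exists>r>0. \<exists>E. (\<forall>n\<ge>1. E n \<in> events \<and> (AE w in M. hat n w \<in> ball t r \<longrightarrow> w \<in> E n)) \<and>
        (\<lambda>n. prob (E n)) \<longlonglongrightarrow> 0"
      by (intro local_exclusion[of g t t0 T hat R, OF int int gap cont hat R opt0] t0(1))
    then show ?thesis unfolding excl_def by blast
  qed
  then have "\<forall>t\<in>C. \<exists>p. excl t (fst p) (snd p)" by simp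
  then obtain p where "\<forall>t\<in>C. excl t (fst (p t)) (snd (p t))"
    by (rule bchoice[THEN exE])
  then obtain r E where "\<And>t. t \<in> C \<Longrightarrow> excl t (r t) (E t)"
    using that[of "\<lambda>t. fst (p t)" "\<lambda>t. snd (p t)"] by blast
  then have r: "\<And>t. t \<in> C \<Longrightarrow> 0 < r t"
    and E: "\<And>t n. t \<in> C \<Longrightarrow> 1 \<le> n \<Longrightarrow> E t n \<in> events"
      "\<And>t n. t \<in> C \<Longrightarrow> 1 \<le> n \<Longrightarrow> AE w in M. hat n w \<in> ball t (r t) \<longrightarrow> w \<in> E t n"
    and lim: "\<And>t. t \<in> C \<Longrightarrow> (\<lambda>n. prob (E t n)) \<longlonglongrightarrow> 0"
    unfolding excl_def by blast+
  obtain F where F: "F \<subseteq> C" "finite F" "C \<subseteq> (\<Union>t\<in>F. ball t (r t))"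
  proof (rule compactE_image[OF \<open>compact C\<close>, of C "\<lambda>t. ball t (r t)"])
    show "C \<subseteq> (\<Union>t\<in>C. ball t (r t))" using r by force
  qed auto
  show "(\<lambda>n. prob {w \<in> space M. e < \<bar>infnorm_dist (hat n w) T0\<bar>}) \<longlonglongrightarrow> 0"
  proof (rule Lim_null_comparison)
    show "(\<lambda>n. \<Sum>t\<in>F. prob (E t n)) \<longlonglongrightarrow> 0"
      using F lim by (intro tendsto_null_sum) auto
    show "eventually (\<lambda>n. norm (prob {w \<in> space M. e < \<bar>infnorm_dist (hat n w) T0\<bar>})
        \<le> (\<Sum>t\<in>F. prob (E t n))) sequentially"
      using eventually_ge_at_top[of 1]
    proof eventually_elim
      case (elim n)
      have far: "hat n w \<in> C" if w: "w \<in> space M" "e < \<bar>infnorm_dist (hat n w) T0\<bar>" for w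
      proof -
        have bdd: "bdd_below ((\<lambda>s. infnorm (hat n w - s)) ` T0)"
          by (rule bdd_belowI[of _ 0]) (auto simp: infnorm_pos_le)
        have "0 \<le> infnorm_dist (hat n w) T0"
          unfolding infnorm_dist_def using t0 by (intro cINF_greatest) (auto simp: infnorm_pos_le)
        moreover have "infnorm_dist (hat n w) T0 \<le> infnorm (hat n w - s)" if "s \<in> T0" for s
          unfolding infnorm_dist_def by (rule cINF_lower[OF bdd that])
        ultimately have "e < infnorm (hat n w - s)" if "s \<in> T0" for s
          using w that by force
        then show ?thesis using hat[OF elim w(1)] unfolding C_def by force
      qed
      have "AE w in M. \<forall>t\<in>F. hat n w \<in> ball t (r t) \<longrightarrow> w \<in> E t n"
        using F by (intro AE_finite_allI E elim) auto
      then have "AE w in M. w \<in> {w \<in> space M. e < \<bar>infnorm_dist (hat n w) T0\<bar>} \<longrightarrow> w \<in> (\<Union>t\<in>F. E t n)"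
        by eventually_elim (use far F in blast)
      then have "prob {w \<in> space M. e < \<bar>infnorm_dist (hat n w) T0\<bar>} \<le> prob (\<Union>t\<in>F. E t n)"
        by (rule finite_measure_mono_AE) (use E F elim in blast)
      also have "\<dots> \<le> (\<Sum>t\<in>F. prob (E t n))"
        using E F elim by (intro measure_UNION_le) auto
      finally show ?case by simp
    qed
  qed
qed

end

section \<open>Losses with integrable derivative bound\<close>

lemma linear_le_infnorm_form:
  fixes l :: "'a::euclidean_space \<Rightarrow> real"
  assumes l: "bounded_linear l"
  shows "\<bar>l v\<bar> \<le> infnorm_form l * norm v"
proof -
  interpret bounded_linear l by fact
  have bdd: "bdd_above (l ` {t. infnorm t = 1})"
  proof (rule bdd_aboveI2)
    fix t :: 'a assume "t \<in> {t. infnorm t = 1}"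
    then have "norm t \<le> sqrt DIM('a)" using norm_le_infnorm[of t] by simp
    then have "onorm l * norm t \<le> onorm l * sqrt DIM('a)"
      by (intro mult_left_mono onorm_pos_le l)
    with onorm[OF l, of t] show "l t \<le> onorm l * sqrt DIM('a)" by simp
  qed
  have le: "l u \<le> infnorm_form l * infnorm u" if "u \<noteq> 0" for u
  proof -
    have pos: "0 < infnorm u" using that by (simp add: infnorm_pos_lt)
    have "l ((1 / infnorm u) *\<^sub>R u) \<le> infnorm_form l"
      unfolding infnorm_form_def
      by (rule cSUP_upper[OF _ bdd]) (use pos in \<open>simp add: infnorm_mul\<close>)
    then show ?thesis using pos by (simp add: scaleR field_simps)
  qed
  show ?thesis
  proof (cases "v = 0")
    case True
    then show ?thesis by (simp add: zero)
  next
    case False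
    have "\<bar>l v\<bar> \<le> infnorm_form l * infnorm v"
      using le[of v] le[of "- v"] False linear_neg[OF bounded_linear.linear[OF l], of v]
      by (simp add: infnorm_neg abs_le_iff)
    moreover from this have "0 \<le> infnorm_form l"
      using False infnorm_pos_lt[of v] by (meson abs_ge_zero order_trans zero_le_mult_iff not_le)
    ultimately show ?thesis
      using mult_left_mono[OF infnorm_le_norm[of v], of "infnorm_form l"] by linarith
  qed
qed

lemma le_enn2real:
  assumes "ennreal a \<le> b" "b < \<infinity>"
  shows "a \<le> enn2real b"
  using assms by (cases b) (auto simp: ennreal_le_iff2)

lemma sup_deriv_norm_Lipschitz:
  fixes L :: "'t::euclidean_space \<Rightarrow> 'x \<Rightarrow> real"
  assumes C1: "C1_on (\<lambda>t. L t x) U" and fin: "sup_deriv_norm L U x < \<infinity>"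
    and S: "convex S" "S \<subseteq> U" "s \<in> S" "t \<in> S"
  shows "\<bar>L s x - L t x\<bar> \<le> enn2real (sup_deriv_norm L U x) * norm (s - t)"
proof -
  let ?D = "\<lambda>u. frechet_derivative (\<lambda>t. L t x) (at u)"
  obtain g' :: "'t \<Rightarrow> 't \<Rightarrow>\<^sub>L real"
    where g': "\<And>u. u \<in> U \<Longrightarrow> ((\<lambda>t. L t x) has_derivative blinfun_apply (g' u)) (at u)"
    using C1 unfolding C1_on_def by blast
  have der: "((\<lambda>t. L t x) has_derivative ?D u) (at u)" if "u \<in> U" for u
    using g'[OF that] frechet_derivative_works differentiableI by blast
  have on: "onorm (?D u) \<le> enn2real (sup_deriv_norm L U x)" if u: "u \<in> U" for u
  proof (rule onorm_bound)
    fix v :: 't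
    have "ennreal (infnorm_form (?D u)) \<le> sup_deriv_norm L U x"
      unfolding sup_deriv_norm_def using u by (intro SUP_upper)
    then have "infnorm_form (?D u) \<le> enn2real (sup_deriv_norm L U x)"
      using fin by (rule le_enn2real)
    then have "infnorm_form (?D u) * norm v \<le> enn2real (sup_deriv_norm L U x) * norm v"
      by (rule mult_right_mono) simp
    then show "norm (?D u v) \<le> enn2real (sup_deriv_norm L U x) * norm v"
      using linear_le_infnorm_form[OF has_derivative_bounded_linear[OF der[OF u]], of v] by simp
  qed simp
  have "norm (L s x - L t x) \<le> enn2real (sup_deriv_norm L U x) * norm (s - t)"
    by (rule differentiable_bound[where S = S and f = "\<lambda>t. L t x" and f' = ?D])
       (use S on der in \<open>auto intro: has_derivative_at_withinI\<close>)
  then show ?thesis by simp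
qed

text \<open>The supremum of the derivative norms need not be measurable, so its
  \<open>nn_integral\<close> is only a lower integral and it cannot itself serve as a dominating function.
  Instead, the difference quotients \<open>\<bar>L s x - L t x\<bar> / r\<close> are maximized over a countable dense set of
  parameters \<open>s\<close>; this yields a measurable function below the supremum, and monotonicity of the lower
  integral bounds its integral.  Continuity in the parameter extends the estimate to the whole
  ball.\<close>

lemma L1_continuous_at_of_deriv_bound:
  fixes L :: "'t::euclidean_space \<Rightarrow> 'x \<Rightarrow> real"
  assumes U: "open U" "T \<subseteq> U" and t: "t \<in> T"
    and meas: "\<And>s. s \<in> T \<Longrightarrow> L s \<in> borel_measurable P"
    and C1: "AE x in P. C1_on (\<lambda>t. L t x) U"
    and fin: "AE x in P. sup_deriv_norm L U x < \<infinity>"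
    and L1: "(\<integral>\<^sup>+x. sup_deriv_norm L U x \<partial>P) < \<infinity>"
  shows "L1_continuous_at P L T t"
  unfolding L1_continuous_at_def
proof (intro allI impI)
  fix e :: real assume e: "0 < e"
  define A where "A = enn2real (\<integral>\<^sup>+x. sup_deriv_norm L U x \<partial>P)"
  have A: "0 \<le> A" "(\<integral>\<^sup>+x. sup_deriv_norm L U x \<partial>P) = ennreal A"
    unfolding A_def using L1 by simp_all
  obtain r0 where r0: "0 < r0" "ball t r0 \<subseteq> U"
    using U t openE by blast
  \<comment> \<open>The summand 1 covers the case \<open>A = 0\<close>.\<close>
  define r where "r = min r0 (e / (A + 1))"
  have r: "0 < r" "ball t r \<subseteq> U" and rA: "r * A \<le> e"
  proof -
    show "0 < r" "ball t r \<subseteq> U" unfolding r_def using r0 e A by auto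
    have "r * A \<le> (e / (A + 1)) * (A + 1)"
      unfolding r_def using e A by (intro mult_mono) auto
    then show "r * A \<le> e" using A by simp
  qed
  let ?S = "T \<inter> ball t r"
  obtain D where D: "countable D" "D \<subseteq> ?S" "?S \<subseteq> closure D"
    by (rule separable)
  define G where "G = (\<lambda>x. SUP s\<in>D. ennreal (\<bar>L s x - L t x\<bar> / r))"
  have "(\<lambda>x. ennreal (\<bar>L s x - L t x\<bar> / r)) \<in> borel_measurable P" if "s \<in> T" for s
    using meas[OF that] meas[OF t] by measurable
  then have Gm [measurable]: "G \<in> borel_measurable P"
    unfolding G_def by (intro borel_measurable_SUP D) (use D in auto)
  have "AE x in P. G x \<le> sup_deriv_norm L U x"
    using C1 fin
  proof eventually_elim
    case (elim x)
    show ?case unfolding G_def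
    proof (rule SUP_least)
      fix s assume "s \<in> D"
      then have s: "s \<in> ball t r" using D by auto
      have "\<bar>L s x - L t x\<bar> \<le> enn2real (sup_deriv_norm L U x) * norm (s - t)"
        by (rule sup_deriv_norm_Lipschitz[where S = "ball t r"]) (use elim r s in auto)
      also have "\<dots> \<le> enn2real (sup_deriv_norm L U x) * r"
        using s by (intro mult_left_mono) (auto simp: dist_norm norm_minus_commute)
      finally have "\<bar>L s x - L t x\<bar> / r \<le> enn2real (sup_deriv_norm L U x)"
        using r by (simp add: field_simps)
      then have "ennreal (\<bar>L s x - L t x\<bar> / r) \<le> ennreal (enn2real (sup_deriv_norm L U x))"
        by (rule ennreal_leI)
      then show "ennreal (\<bar>L s x - L t x\<bar> / r) \<le> sup_deriv_norm L U x"
        using elim(2) ennreal_enn2real[of "sup_deriv_norm L U x"] by (simp only: infinity_ennreal_def)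
    qed
  qed
  then have GA: "(\<integral>\<^sup>+x. G x \<partial>P) \<le> ennreal A"
    using nn_integral_mono_AE[of G "sup_deriv_norm L U" P] A by simp
  then have Gfin: "AE x in P. G x \<noteq> \<infinity>"
    by (intro nn_integral_PInf_AE Gm) (auto simp: top_unique)
  define B where "B = (\<lambda>x. r * enn2real (G x))"
  have eq: "(\<integral>\<^sup>+x. ennreal (enn2real (G x)) \<partial>P) = (\<integral>\<^sup>+x. G x \<partial>P)"
    by (intro nn_integral_cong_AE) (use Gfin in \<open>auto elim!: eventually_mono simp: less_top\<close>)
  have iG: "integrable P (\<lambda>x. enn2real (G x))"
    by (rule integrableI_nonneg)
       (use GA eq in \<open>auto intro: le_less_trans[OF _ ennreal_less_top]\<close>)
  have "(\<integral>x. enn2real (G x) \<partial>P) \<le> A"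
  proof -
    have "ennreal (\<integral>x. enn2real (G x) \<partial>P) \<le> ennreal A"
      using nn_integral_eq_integral[OF iG] GA eq by simp
    then show ?thesis using A by (simp add: ennreal_le_iff)
  qed
  then have "r * (\<integral>x. enn2real (G x) \<partial>P) \<le> e"
    using rA r by (meson mult_left_mono less_imp_le order_trans)
  then have "integrable P B" "(\<integral>x. B x \<partial>P) \<le> e"
    unfolding B_def using iG by simp_all
  moreover have "AE x in P. \<forall>s\<in>?S. \<bar>L s x - L t x\<bar> \<le> B x"
    using C1 Gfin
  proof eventually_elim
    case (elim x)
    have on_D: "\<bar>L s x - L t x\<bar> \<le> B x" if "s \<in> D" for s
    proof -
      have "ennreal (\<bar>L s x - L t x\<bar> / r) \<le> G x"
        unfolding G_def using that by (intro SUP_upper)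
      then have "\<bar>L s x - L t x\<bar> / r \<le> enn2real (G x)"
        by (rule le_enn2real) (use elim(2) in \<open>simp add: less_top\<close>)
      then show ?thesis unfolding B_def using r by (simp add: field_simps)
    qed
    show ?case
    proof
      fix s assume s: "s \<in> ?S"
      then obtain u where u: "\<And>n. u n \<in> D" "u \<longlonglongrightarrow> s"
        using D(3) by (meson closure_sequential subsetD)
      have "isCont (\<lambda>t. L t x) s"
        using elim(1) s U(2) unfolding C1_on_def by (meson IntD1 has_derivative_continuous subsetD)
      then have "(\<lambda>n. \<bar>L (u n) x - L t x\<bar>) \<longlonglongrightarrow> \<bar>L s x - L t x\<bar>"
        using u(2) by (intro tendsto_intros isCont_tendsto_compose[of s "\<lambda>t. L t x"])
      then show "\<bar>L s x - L t x\<bar> \<le> B x"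
        by (rule LIMSEQ_le_const2) (use on_D u(1) in blast)
    qed
  qed
  ultimately show "\<exists>r>0. \<exists>B. integrable P B \<and> (\<integral>x. B x \<partial>P) \<le> e \<and>
      (AE x in P. \<forall>s\<in>T \<inter> ball t r. \<bar>L s x - L t x\<bar> \<le> B x)"
    using r by blast
qed

section \<open>The conditional classification likelihood\<close>

theorem theorem3p2:
  fixes M :: "'w measure"
    and X :: "nat \<Rightarrow> 'w \<Rightarrow> real^'d"
    and f :: "real^'d \<Rightarrow> real"
    and K :: nat
    and par :: "real^'D \<Rightarrow> 'd mixture"
    and \<Theta> \<Theta>O \<Theta>0 :: "(real^'D) set"
    and est :: "nat \<Rightarrow> (nat \<Rightarrow> real^'d) \<Rightarrow> real^'D"
    and hat :: "nat \<Rightarrow> 'w \<Rightarrow> real^'D"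
    and M' :: "real^'d \<Rightarrow> ennreal"
  defines "M' \<equiv> sup_deriv_norm (\<lambda>\<theta>. log_Lcc K (par \<theta>)) \<Theta>O"
    and "\<Theta>0 \<equiv> {\<theta>. is_arg_min
           (\<lambda>\<theta>. \<integral>x. - log_Lcc K (par \<theta>) x \<partial>density lborel f) (\<lambda>\<theta>. \<theta> \<in> \<Theta>) \<theta>}"
    and "hat \<equiv> \<lambda>n w. est n (\<lambda>i\<in>{1..n}. X i w)"
  assumes prob: "prob_space M"
    and f_nonneg: "\<And>x. 0 \<le> f x"
    and X_density: "\<And>i. 1 \<le> i \<Longrightarrow> distributed M lborel (X i) f"
    and X_indep: "prob_space.indep_vars M (\<lambda>_. borel) X {1..}"
    and K: "1 \<le> K"
    and model: "\<And>\<theta>. \<theta> \<in> \<Theta> \<Longrightarrow> is_gaussian_mixture K (par \<theta>)"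
    and compact: "compact \<Theta>"
    and "open \<Theta>O"
    and "\<Theta> \<subseteq> \<Theta>O"
    and finite_expectation: "\<And>\<theta>. \<theta> \<in> \<Theta> \<Longrightarrow> integrable (density lborel f) (log_Lcc K (par \<theta>))"
    and regular: "AE x in density lborel f.
           (\<forall>\<theta>\<in>\<Theta>O. log_Lcc_defined K (par \<theta>) x) \<and> C1_on (\<lambda>\<theta>. log_Lcc K (par \<theta>) x) \<Theta>O"
    and M'_finite: "AE x in density lborel f. M' x < \<infinity>"
    and M'_L1: "(\<integral>\<^sup>+x. M' x \<partial>density lborel f) < \<infinity>"
    and est_measurable: "\<And>n. 1 \<le> n \<Longrightarrow> est n \<in> borel_measurable (\<Pi>\<^sub>M i\<in>{1..n}. borel)"
    and est_in: "\<And>n xs. 1 \<le> n \<Longrightarrow> xs \<in> space (\<Pi>\<^sub>M i\<in>{1..n}. borel) \<Longrightarrow> est n xs \<in> \<Theta>"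
    and almost_max: "\<And>\<theta>0. \<theta>0 \<in> \<Theta>0 \<Longrightarrow> \<exists>R. little_o_prob M R real \<and>
           (\<forall>n\<ge>1. AE w in M.
              - sample_log_Lcc K (par (hat n w)) n (\<lambda>i. X i w)
              \<le> - sample_log_Lcc K (par \<theta>0) n (\<lambda>i. X i w) + R n w)"
  shows "tends_to_0_in_prob M (\<lambda>n w. infnorm_dist (hat n w) \<Theta>0)"
proof -
  let ?P = "density lborel f"
  interpret prob_space M by (rule prob)
  interpret iid_sample M borel ?P X
  proof
    show "indep_vars (\<lambda>_. borel) X {1..}" by (rule X_indep)
    show "distr M borel (X i) = ?P" if "1 \<le> i" for i
      using distributed_distr_eq_density[OF X_density[OF that]] by (metis distr_cong sets_lborel)
  qed
  let ?g = "\<lambda>\<theta> x. - log_Lcc K (par \<theta>) x"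
  have cont: "L1_continuous_at ?P ?g \<Theta> \<theta>" if "\<theta> \<in> \<Theta>" for \<theta>
  proof (rule L1_continuous_at_uminus, rule L1_continuous_at_of_deriv_bound)
    show "AE x in ?P. C1_on (\<lambda>\<theta>. log_Lcc K (par \<theta>) x) \<Theta>O"
      using regular by eventually_elim blast
    show "log_Lcc K (par s) \<in> borel_measurable ?P" if "s \<in> \<Theta>" for s
      using finite_expectation[OF that] by (rule borel_measurable_integrable)
  qed (use that \<open>open \<Theta>O\<close> \<open>\<Theta> \<subseteq> \<Theta>O\<close> M'_finite M'_L1 in \<open>auto simp: M'_def\<close>)
  have hat_in: "hat n w \<in> \<Theta>" if "1 \<le> n" for n w
    unfolding hat_def by (rule est_in[OF that]) (auto simp: space_PiM)
  then have "\<Theta> \<noteq> {}" by blast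
  show ?thesis
    unfolding \<Theta>0_def
  proof (rule argmin_estimator_consistent)
    show "integrable ?P (?g \<theta>)" if "\<theta> \<in> \<Theta>" for \<theta>
      using finite_expectation[OF that] by simp
    show "\<exists>R. little_o_prob M R real \<and> (\<forall>n\<ge>1. AE w in M.
        (\<Sum>i=1..n. ?g (hat n w) (X i w)) \<le> (\<Sum>i=1..n. ?g \<theta>0 (X i w)) + R n w)"
      if "\<theta>0 \<in> {\<theta>. is_arg_min (\<lambda>\<theta>. \<integral>x. ?g \<theta> x \<partial>?P) (\<lambda>\<theta>. \<theta> \<in> \<Theta>) \<theta>}" for \<theta>0
      using almost_max[unfolded \<Theta>0_def, OF that] by (simp add: sample_log_Lcc_def sum_negf)
  qed (use compact \<open>\<Theta> \<noteq> {}\<close> cont hat_in in auto)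
qed

end
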